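(* Let $R_0\in\mathcal{R}$ have support $\mathbb{X}$ and let $\mathbf{R}$ be an $\mathcal{R}$-valued random variable such that the distribution mean $E^{\dagger}\mathbf{R}$ exists and the distribution variance $V^{\dagger}\mathbf{R}$ is finite. Then for any $P\in\mathcal{P}$, where $\mathcal{P}$ is an exponential family, the mean KL divergence between $\mathbf{R}$ and $P$ depends only on the distribution mean and distribution variance: $$E[D(\mathbf{R},P)]=D(E^{\dagger}\mathbf{R},P)+V^{\dagger}\mathbf{R}\qquad\text{for all }P\in\mathcal{P}.$$ Assuming the conditional expectations and variances exist, the distribution mean and distribution variance satisfy the classical conditional equalities $$E^{\dagger}\mathbf{R}=E^{\dagger}E^{\dagger}[\mathbf{R}\mid S],\qquad V^{\dagger}\mathbf{R}=V^{\dagger}E^{\dagger}[\mathbf{R}\mid S]+E[V^{\dagger}(\mathbf{R}\mid S)],$$ where $S$ is a real-valued random vector. Furthermore, the expectation property holds for the canonical statistic $T$ of $\mathcal{P}$: $$\mu(E^{\dagger}\mathbf{R})=E[\mu(\mathbf{R})].$$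
   Context: $(\mathbb{X},\mathscr{X})$ is a sample space with a $\sigma$-finite measure $\lambda$ (usually counting measure when $\mathbb{X}$ is finite or countable, and Lebesgue measure when $\mathbb{X}\subset\mathbb{R}^d$ contains an open set). $\mathcal{R}$ is the set of all probability measures on $(\mathbb{X},\mathscr{X})$ absolutely continuous with respect to $\lambda$; lower case letters denote densities with respect to $\lambda$. $X_1,\dots,X_n$ are i.i.d. from $R_0$, and expectations $E$ of real- or vector-valued quantities are taken under $R_0$. An $\mathcal{R}$-valued random variable $\mathbf{R}$ is an estimator, i.e. a map $\mathbf{x}\mapsto\mathbf{R}_{\mathbf{x}}$ from $\mathbb{X}^n$ to $\mathcal{R}$ evaluated at the sample $(X_1,\dots,X_n)$, such that $\mathbf{R}(A)$ is a real-valued random variable for each $A\in\mathscr{X}$. $D(R_1,R_2)=E_{R_1}\log(r_1/r_2)$ is the Kullback-Leibler (KL) divergence. $R_0$ is fixed but arbitrary, other than having support $\mathbb{X}$ and constraints ensuring that the quantities in the expressions exist. $\mathcal{P}\subset\mathcal{R}$ is an exponential family on $\mathbb{X}$ if there exist $P_0\in\mathcal{R}$ with support $\mathbb{X}$ and a function $T:\mathbb{X}\to\mathbb{R}^d$ (the canonical statistic) such that every $P\in\mathcal{P}$ satisfies $dP\propto e^{\theta'T(x)}dP_0$ for some $\theta\in\mathbb{R}^d$. Write $\mu(R)=E_RT$ for $R\in\mathcal{R}$; thus $\mu(\mathbf{R})$ is an $\mathbb{R}^d$-valued random variable. Distribution variance: $V^{\dagger}\mathbf{R}=\inf_{P\in\mathcal{P}}E[D(\mathbf{R},P)]$.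 Distribution mean: $E^{\dagger}\mathbf{R}=\arg\min_{P\in\mathcal{P}}E[D(\mathbf{R},P)]$ if the minimum exists, in which case $V^{\dagger}\mathbf{R}=E[D(\mathbf{R},E^{\dagger}\mathbf{R})]$. Conditional versions are the same objects computed under the conditional distribution of the sample given $S=s$: $E^{\dagger}[\mathbf{R}\mid s]=\arg\min_{P\in\mathcal{P}}E[D(\mathbf{R},P)\mid S=s]$ and $V^{\dagger}(\mathbf{R}\mid s)=\inf_{P\in\mathcal{P}}E[D(\mathbf{R},P)\mid S=s]$. Replacing $s$ by the random vector $S$ (jointly distributed with $\mathbf{R}$), $E^{\dagger}[\mathbf{R}\mid S]$ is an $\mathcal{R}$-valued random variable to which $E^{\dagger}$ and $V^{\dagger}$ apply, and $V^{\dagger}(\mathbf{R}\mid S)$ is a real-valued random variable.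
   Formalization: The set of canonical parameters θ of the exponential family is additionally assumed to be open in R^d; for arbitrary subsets of a full family (e.g. two Bernoulli laws, R constant outside the family) the stated identity is false. *)

theory Defs
  imports "HOL-Probability.Probability"
begin

text \<open>
  The set of probability measures on the sample space that are absolutely continuous with
  respect to the dominating measure \<open>lam\<close>.
\<close>

definition dominated_probs :: "'a measure \<Rightarrow> 'a measure set" where
  "dominated_probs lam =
     {R. prob_space R \<and> sets R = sets lam \<and> absolutely_continuous lam R}"

text \<open>
  The sample space carries no topology, so "\<open>R\<close> has support equal to the whole space" refers to
  the set where the density with respect to \<open>lam\<close> is positive, up to \<open>lam\<close>-null sets.
\<close>

definition full_support :: "'a measure \<Rightarrow> 'a measure \<Rightarrow> bool" where
  "full_support lam R \<longleftrightarrow> (AE x in lam. 0 < RN_deriv lam R x)"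

text \<open>
  Kullback-Leibler divergence \<open>D(R1,R2)\<close>, the \<open>R1\<close>-expectation of \<open>log (r1/r2)\<close>, with values in
  \<open>[0,\<infinity>]\<close>. The library's \<open>KL_divergence\<close> takes the reference measure first, is real valued,
  and is 0 when the integral does not exist. The negative part of \<open>log (r1/r2)\<close> always has a finite
  \<open>R1\<close>-integral, so non-integrability means that the divergence is infinite.
\<close>

definition KL :: "'a measure \<Rightarrow> 'a measure \<Rightarrow> ennreal" where
  "KL R1 R2 =
     (if absolutely_continuous R2 R1 \<and> integrable R1 (entropy_density (exp 1) R2 R1)
      then ennreal (KL_divergence (exp 1) R2 R1) else \<infinity>)"

text \<open>\<open>dP \<propto> exp (\<theta>'T) dP0\<close>; the constant is determined by \<open>P\<close> being a probability measure.\<close>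

definition exp_tilt ::
    "'a measure \<Rightarrow> ('a \<Rightarrow> real ^ 'd) \<Rightarrow> real ^ 'd \<Rightarrow> 'a measure \<Rightarrow> bool" where
  "exp_tilt P0 T \<theta> P \<longleftrightarrow> (\<exists>c>0. P = density P0 (\<lambda>x. ennreal (c * exp (\<theta> \<bullet> T x))))"

definition exponential_family ::
    "'a measure \<Rightarrow> 'a measure \<Rightarrow> ('a \<Rightarrow> real ^ 'd) \<Rightarrow> 'a measure set \<Rightarrow> bool" where
  "exponential_family lam P0 T \<P> \<longleftrightarrow>
     P0 \<in> dominated_probs lam \<and> full_support lam P0 \<and> T \<in> borel_measurable lam \<and>
     \<P> \<subseteq> dominated_probs lam \<and> (\<forall>P\<in>\<P>. \<exists>\<theta>. exp_tilt P0 T \<theta> P)"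

text \<open>
  An exponential family may be an arbitrary subset of the full family generated by \<open>P0\<close> and \<open>T\<close>.
  Openness of the following set of canonical parameters is what excludes curved families and
  minimizers on the boundary, for which the Pythagorean identity fails.
\<close>

definition canonical_params ::
    "'a measure \<Rightarrow> ('a \<Rightarrow> real ^ 'd) \<Rightarrow> 'a measure set \<Rightarrow> (real ^ 'd) set" where
  "canonical_params P0 T \<P> = {\<theta>. \<exists>P\<in>\<P>. exp_tilt P0 T \<theta> P}"

definition mean_stat :: "('a \<Rightarrow> real ^ 'd) \<Rightarrow> 'a measure \<Rightarrow> real ^ 'd" where
  "mean_stat T R = (\<integral>x. T x \<partial>R)"

text \<open>
  In the next definitions \<open>M\<close> is the probability space over which the expectation is taken and
  \<open>Rv\<close> is a random distribution on it. Taking for \<open>M\<close> a conditional distribution of the sample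
  gives the conditional distribution mean and variance.
\<close>

definition mean_KL :: "'w measure \<Rightarrow> ('w \<Rightarrow> 'a measure) \<Rightarrow> 'a measure \<Rightarrow> ennreal" where
  "mean_KL M Rv P = (\<integral>\<^sup>+ \<omega>. KL (Rv \<omega>) P \<partial>M)"

definition dist_var :: "'a measure set \<Rightarrow> 'w measure \<Rightarrow> ('w \<Rightarrow> 'a measure) \<Rightarrow> ennreal" where
  "dist_var \<P> M Rv = (INF P\<in>\<P>. mean_KL M Rv P)"

definition dist_mean_exists ::
    "'a measure set \<Rightarrow> 'w measure \<Rightarrow> ('w \<Rightarrow> 'a measure) \<Rightarrow> bool" where
  "dist_mean_exists \<P> M Rv \<longleftrightarrow> (\<exists>Q. is_arg_min (mean_KL M Rv) (\<lambda>P. P \<in> \<P>) Q)"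

definition dist_mean ::
    "'a measure set \<Rightarrow> 'w measure \<Rightarrow> ('w \<Rightarrow> 'a measure) \<Rightarrow> 'a measure" where
  "dist_mean \<P> M Rv = arg_min (mean_KL M Rv) (\<lambda>P. P \<in> \<P>)"

abbreviation sample_space :: "nat \<Rightarrow> 'a measure \<Rightarrow> (nat \<Rightarrow> 'a) measure" where
  "sample_space n lam \<equiv> PiM {..<n} (\<lambda>_. lam)"

definition sample_vec :: "nat \<Rightarrow> (nat \<Rightarrow> 'w \<Rightarrow> 'a) \<Rightarrow> 'w \<Rightarrow> nat \<Rightarrow> 'a" where
  "sample_vec n X \<omega> = (\<lambda>i\<in>{..<n}. X i \<omega>)"

definition iid_sample ::
    "'w measure \<Rightarrow> 'a measure \<Rightarrow> nat \<Rightarrow> (nat \<Rightarrow> 'w \<Rightarrow> 'a) \<Rightarrow> 'a measure \<Rightarrow> bool" where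
  "iid_sample M lam n X R0 \<longleftrightarrow>
     prob_space.indep_vars M (\<lambda>_. lam) X {..<n} \<and> (\<forall>i<n. distr M lam (X i) = R0)"

text \<open>
  The last condition says that \<open>E[D(R,P)]\<close> makes sense. It does not follow from measurability of
  all the \<open>R(A)\<close> when the sample space is not countably generated.
\<close>

definition dist_estimator ::
    "'a measure \<Rightarrow> 'a measure set \<Rightarrow> nat \<Rightarrow> ((nat \<Rightarrow> 'a) \<Rightarrow> 'a measure) \<Rightarrow> bool" where
  "dist_estimator lam \<P> n R \<longleftrightarrow>
     (\<forall>x\<in>space (sample_space n lam). R x \<in> dominated_probs lam) \<and>
     (\<forall>A\<in>sets lam. (\<lambda>x. measure (R x) A) \<in> borel_measurable (sample_space n lam)) \<and>
     (\<forall>P\<in>\<P>. (\<lambda>x. KL (R x) P) \<in> borel_measurable (sample_space n lam))"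

text \<open>\<open>\<kappa> s\<close> is a regular conditional distribution of the \<open>N\<close>-valued variable \<open>Y\<close> given \<open>S = s\<close>.\<close>

definition cond_distribution ::
    "'w measure \<Rightarrow> 'y measure \<Rightarrow> ('w \<Rightarrow> 'y) \<Rightarrow> ('w \<Rightarrow> real ^ 'k) \<Rightarrow> (real ^ 'k \<Rightarrow> 'y measure) \<Rightarrow> bool"
  where
  "cond_distribution M N Y S \<kappa> \<longleftrightarrow>
     \<kappa> \<in> measurable borel (prob_algebra N) \<and>
     (\<forall>A\<in>sets borel. \<forall>B\<in>sets N.
        emeasure M {\<omega>\<in>space M. S \<omega> \<in> A \<and> Y \<omega> \<in> B} =
        (\<integral>\<^sup>+ s\<in>A. emeasure (\<kappa> s) B \<partial>distr M borel S))"

end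

theory Submission
  imports Defs
begin

text \<open>
  All members of an exponential family with open parameter set are mutual exponential tilts with
  exponential moments around \<open>0\<close>. Young's inequality \<open>r y \<le> r ln r + exp y\<close> then makes \<open>T\<close> integrable
  under every \<open>R\<close> of finite divergence from some member, so that \<open>D(R, P)\<close>, and hence
  \<open>E[D(\<^bold>R, P)]\<close>, changes with the parameter of \<open>P\<close> by a term affine in the mean of \<open>T\<close> plus the
  log-normalizer. At a minimizer \<open>Q\<close>, an interior point, the first-order condition reads
  \<open>E\<^sub>Q T = E[\<mu>(\<^bold>R)]\<close>; inserting it gives the Pythagorean identity.

  For the conditional statements the identity is applied to almost every conditional distribution
  and integrated. Given \<open>S = s\<close>, the mean divergence from \<open>P\<close> splits into \<open>D(Q\<^sub>s, P)\<close> and the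
  conditional variance. Both summands are measurable in \<open>s\<close>, because \<open>D(Q\<^sub>s, P)\<close> is a supremum of
  continuous functions of the conditional mean of \<open>T\<close>. Thus \<open>E[D(\<^bold>R, P)]\<close> and \<open>E[D(E\<^sup>\<dagger>[\<^bold>R|S], P)]\<close>
  differ by a finite constant on the family and have the same minimizers.
\<close>

section \<open>Finite divergences and their change under exponential tilting\<close>

lemma (in prob_space) real_density_of_ac:
  assumes "prob_space R" "absolutely_continuous M R" "sets R = sets M"
  obtains D :: "'a \<Rightarrow> real" where "D \<in> borel_measurable M" "\<And>x. 0 \<le> D x" "R = density M D"
    "AE x in R. 0 < D x" "AE x in R. RN_deriv M R x = ennreal (D x)"
proof -
  interpret R: prob_space R by fact
  have "finite_measure R" by unfold_locales
  from real_RN_deriv[OF this assms(2,3)] obtain D where D: "D \<in> borel_measurable M"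
    "AE x in M. RN_deriv M R x = ennreal (D x)" "AE x in R. 0 < D x" "\<And>x. 0 \<le> D x" by blast
  have "R = density M (RN_deriv M R)"
    using assms(2,3) by (rule density_RN_deriv[symmetric])
  also have "\<dots> = density M D" using D by (auto intro!: density_cong)
  finally show ?thesis
    using that D absolutely_continuous_AE[OF assms(3,2) D(2)] by blast
qed

lemma KL_nonneg_ac:
  assumes "prob_space P" "prob_space R" "absolutely_continuous P R" "sets R = sets P"
    and int: "integrable R (entropy_density (exp 1) P R)"
  shows "0 \<le> KL_divergence (exp 1) P R"
proof -
  interpret P: prob_space P by fact
  interpret I: information_space P "exp 1" by unfold_locales simp
  obtain D where D: "D \<in> borel_measurable P" "\<And>x. 0 \<le> D x" "R = density P D"
    "AE x in R. 0 < D x" "AE x in R. RN_deriv P R x = ennreal (D x)"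
    using P.real_density_of_ac[OF assms(2-4)] by metis
  have "integrable R (\<lambda>x. log (exp 1) (D x))"
    using D(1,5) assms(4) int
    by (intro integrable_cong_AE[THEN iffD2, OF _ _ _ int])
       (auto simp: entropy_density_def D(2) measurable_cong_sets[OF assms(4) refl])
  then have "integrable P (\<lambda>x. D x * log (exp 1) (D x))"
    using D(1,2) by (subst integrable_real_density[symmetric]) (auto simp: D(3)[symmetric])
  then show ?thesis using I.KL_nonneg[of D] D assms(2) by auto
qed

text \<open>The nonnegativity is recorded along with the formula because \<open>ennreal\<close>
  truncates negative reals to 0. With it, \<open>enn2real\<close> recovers the integral from
  \<open>KL R P\<close> and real arithmetic becomes available.\<close>

lemma KL_finite:
  assumes "prob_space P" "prob_space R" "absolutely_continuous P R" "sets R = sets P"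
    and "KL R P < \<infinity>"
  shows "integrable R (entropy_density (exp 1) P R)"
    and "KL R P = ennreal (\<integral>x. entropy_density (exp 1) P R x \<partial>R)"
    and "0 \<le> (\<integral>x. entropy_density (exp 1) P R x \<partial>R)"
proof -
  show int: "integrable R (entropy_density (exp 1) P R)"
    using assms(5) by (auto simp: KL_def split: if_splits)
  with assms(3) show "KL R P = ennreal (\<integral>x. entropy_density (exp 1) P R x \<partial>R)"
    by (simp add: KL_def KL_divergence_def)
  show "0 \<le> (\<integral>x. entropy_density (exp 1) P R x \<partial>R)"
    using KL_nonneg_ac[OF assms(1-4) int] by (simp add: KL_divergence_def)
qed

text \<open>By the chain rule for densities, dR/dP is \<open>exp (g x)\<close> times dR/dP'. Taking
  logarithms needs a positive density, which is guaranteed only R-almost everywhere.\<close>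

lemma entropy_density_tilt:
  assumes "prob_space P" "prob_space P'" "prob_space R"
    and "absolutely_continuous P R" "absolutely_continuous P' R"
    and "sets R = sets P"
    and g [measurable]: "g \<in> borel_measurable P"
    and P': "P' = density P (\<lambda>x. ennreal (exp (g x)))"
  shows "AE x in R. entropy_density (exp 1) P R x = entropy_density (exp 1) P' R x + g x"
proof -
  interpret P: prob_space P by fact
  interpret P': prob_space P' by fact
  have sets': "sets R = sets P'" using assms(6) P' by simp
  obtain D where D: "D \<in> borel_measurable P'" "\<And>x. 0 \<le> D x" "R = density P' D"
    "AE x in R. 0 < D x" "AE x in R. RN_deriv P' R x = ennreal (D x)"
    using P'.real_density_of_ac[OF assms(3,5) sets'] by metis
  have [measurable]: "D \<in> borel_measurable P" using D(1) P' by simp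
  have "R = density P' D" by (rule D(3))
  also have "\<dots> = density P (\<lambda>x. ennreal (exp (g x)) * ennreal (D x))"
    unfolding P' by (rule density_density_eq) auto
  finally have "AE x in P. ennreal (exp (g x)) * ennreal (D x) = RN_deriv P R x"
    by (intro P.RN_deriv_unique) auto
  then have "AE x in R. ennreal (exp (g x)) * ennreal (D x) = RN_deriv P R x"
    by (rule absolutely_continuous_AE[OF assms(6,4)])
  then show ?thesis
    using D(4,5)
  proof eventually_elim
    case (elim x)
    have "entropy_density (exp 1) P R x = ln (exp (g x) * D x)"
      using elim D(2)[of x]
      by (simp add: entropy_density_def log_def elim(1)[symmetric] ennreal_mult[symmetric])
    also have "\<dots> = g x + ln (D x)" using elim by (simp add: ln_mult)
    finally show ?case using elim by (simp add: entropy_density_def log_def)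
  qed
qed

lemma KL_tilt:
  assumes "prob_space P" "prob_space P'" "prob_space R"
    and "absolutely_continuous P R" "absolutely_continuous P' R"
    and sets: "sets R = sets P"
    and g [measurable]: "g \<in> borel_measurable P"
    and P': "P' = density P (\<lambda>x. ennreal (exp (g x)))"
    and "integrable R g" and fin: "KL R P < \<infinity>"
  shows "KL R P' < \<infinity>" and "enn2real (KL R P') = enn2real (KL R P) - (\<integral>x. g x \<partial>R)"
proof -
  have sets': "sets R = sets P'" using sets P' by simp
  note ae = entropy_density_tilt[OF assms(1-8)]
  note K = KL_finite[OF assms(1,3,4) sets fin]
  have [measurable]: "entropy_density (exp 1) P R \<in> borel_measurable R"
    "entropy_density (exp 1) P' R \<in> borel_measurable R" "g \<in> borel_measurable R"
    using measurable_entropy_density[of "exp 1" P R] measurable_entropy_density[of "exp 1" P' R] g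
      sets sets' by (auto simp: measurable_cong_sets[OF sets refl] measurable_cong_sets[OF sets' refl])
  have "integrable R (\<lambda>x. entropy_density (exp 1) P R x - g x)"
    using K(1) assms(9) by simp
  then have "integrable R (entropy_density (exp 1) P' R)"
    by (rule integrable_cong_AE[THEN iffD2, rotated 3]) (use ae in auto)
  then show fin': "KL R P' < \<infinity>" using assms(5) by (simp add: KL_def)
  note K' = KL_finite[OF assms(2,3,5) sets' fin']
  have "(\<integral>x. entropy_density (exp 1) P' R x \<partial>R) = (\<integral>x. entropy_density (exp 1) P R x - g x \<partial>R)"
    by (rule integral_cong_AE) (use ae in auto)
  also have "\<dots> = (\<integral>x. entropy_density (exp 1) P R x \<partial>R) - (\<integral>x. g x \<partial>R)"
    using K(1) assms(9) by simp
  finally show "enn2real (KL R P') = enn2real (KL R P) - (\<integral>x. g x \<partial>R)"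
    using K K' by simp
qed

section \<open>Young's inequality and moment bounds\<close>

lemma mult_le_xlnx_plus_exp:
  fixes r y :: real
  assumes "0 \<le> r"
  shows "r * y \<le> r * ln r + exp y"
proof (cases "r = 0")
  case False
  with assms have r: "0 < r" by simp
  \<comment> \<open>The tangent of \<open>exp\<close> at 0, evaluated at \<open>y - ln r\<close>, is
    the Fenchel inequality for \<open>r * ln r - r\<close> and \<open>exp y\<close>; the term
    \<open>- r\<close> is dropped at the end.\<close>
  have "1 + (y - ln r) \<le> exp (y - ln r)" by (rule exp_ge_add_one_self)
  also have "\<dots> = exp y / r" using r by (simp add: exp_diff)
  finally have "r * (1 + (y - ln r)) \<le> r * (exp y / r)" using r by (intro mult_left_mono) auto
  then show ?thesis using r by (simp add: algebra_simps)
qed simp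

text \<open>Young's inequality is applied pointwise with r the density of R and y =
  \<open>\<bar>f x\<bar>\<close>, then integrated against P. An infinite term on the right makes the
  bound trivial.\<close>

lemma nn_integral_abs_le_KL:
  assumes "prob_space P" "prob_space R" "absolutely_continuous P R" "sets R = sets P"
    and f [measurable]: "f \<in> borel_measurable P"
  shows "(\<integral>\<^sup>+x. ennreal \<bar>f x\<bar> \<partial>R) \<le> KL R P + (\<integral>\<^sup>+x. ennreal (exp \<bar>f x\<bar>) \<partial>P)"
proof (cases "KL R P < \<infinity> \<and> (\<integral>\<^sup>+x. ennreal (exp \<bar>f x\<bar>) \<partial>P) < \<infinity>")
  case True
  interpret P: prob_space P by fact
  obtain D where D [measurable]: "D \<in> borel_measurable P"
    and D': "\<And>x. 0 \<le> D x" "AE x in R. 0 < D x" "AE x in R. RN_deriv P R x = ennreal (D x)"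
    and R: "R = density P D"
    using P.real_density_of_ac[OF assms(2-4)] by metis
  note K = KL_finite[OF assms(1-4)]
  have ae: "AE x in R. entropy_density (exp 1) P R x = ln (D x)"
    using D'(3)
    by eventually_elim (use D' in \<open>simp add: entropy_density_def log_def\<close>)
  have [measurable]: "entropy_density (exp 1) P R \<in> borel_measurable R"
     "(\<lambda>x. ln (D x)) \<in> borel_measurable R"
    using assms(4) by (auto simp: measurable_cong_sets[OF assms(4) refl])
  have "integrable R (\<lambda>x. ln (D x))"
    using K(1) True ae by (subst integrable_cong_AE[of _ _ "entropy_density (exp 1) P R"]) auto
  then have int: "integrable P (\<lambda>x. D x * ln (D x))"
    using D' by (subst (asm) R, subst (asm) integrable_real_density) auto
  have "(\<integral>x. entropy_density (exp 1) P R x \<partial>R) = (\<integral>x. ln (D x) \<partial>R)"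
    using ae by (intro integral_cong_AE) auto
  also have "\<dots> = (\<integral>x. D x * ln (D x) \<partial>P)"
    using D' by (subst R, subst integral_real_density) auto
  finally have KL: "KL R P = ennreal (\<integral>x. D x * ln (D x) \<partial>P)" "0 \<le> (\<integral>x. D x * ln (D x) \<partial>P)"
    using K(2,3) True by auto
  have int_exp: "integrable P (\<lambda>x. exp \<bar>f x\<bar>)"
    using True by (intro integrableI_nonneg) auto
  have "(\<integral>\<^sup>+x. ennreal \<bar>f x\<bar> \<partial>R) = (\<integral>\<^sup>+x. ennreal (D x * \<bar>f x\<bar>) \<partial>P)"
    by (subst R, subst nn_integral_density) (use D' in \<open>auto simp: ennreal_mult\<close>)
  also have "\<dots> \<le> (\<integral>\<^sup>+x. ennreal (D x * ln (D x) + exp \<bar>f x\<bar>) \<partial>P)"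
    using D' by (intro nn_integral_mono ennreal_leI mult_le_xlnx_plus_exp)
  also have "\<dots> = ennreal (\<integral>x. D x * ln (D x) + exp \<bar>f x\<bar> \<partial>P)"
  proof (rule nn_integral_eq_integral)
    \<comment> \<open>The summand \<open>D x * ln (D x)\<close> can be negative, but Young's
      inequality bounds the sum below by \<open>D x * \<bar>f x\<bar>\<close>.\<close>
    show "AE x in P. 0 \<le> D x * ln (D x) + exp \<bar>f x\<bar>"
      using D'(1)
      by (intro AE_I2 order_trans[OF _ mult_le_xlnx_plus_exp[OF D'(1)]]) simp
  qed (use int int_exp in simp)
  \<comment> \<open>Splitting \<open>ennreal\<close> over the sum is legitimate because the integral
    of \<open>D x * ln (D x)\<close> is a divergence, hence nonnegative.\<close>
  also have "\<dots> = KL R P + (\<integral>\<^sup>+x. ennreal (exp \<bar>f x\<bar>) \<partial>P)"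
    using int int_exp KL by (simp add: nn_integral_eq_integral)
  finally show ?thesis .
qed (auto simp: not_less top_unique)

text \<open>Both sides of \<open>ge\<close> tend to 1 as t decreases to 0, so the inequality passes
  to their right derivatives there. This is the form in which the first-order condition at a
  minimizer is used.\<close>

lemma (in prob_space) expectation_ge_of_exp_moments:
  fixes Y :: "'a \<Rightarrow> real"
  assumes Y: "integrable M Y" and "0 < s"
    and int: "\<And>t. 0 < t \<Longrightarrow> t \<le> s \<Longrightarrow> integrable M (\<lambda>x. exp (t * Y x))"
    and ge: "\<And>t. 0 < t \<Longrightarrow> t \<le> s \<Longrightarrow> exp (t * y) \<le> expectation (\<lambda>x. exp (t * Y x))"
  shows "y \<le> expectation Y"
proof -
  have [measurable]: "Y \<in> borel_measurable M" using Y by simp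
  txt \<open>The difference quotients of \<open>t \<mapsto> exp (t Y)\<close> at \<open>0\<close> are at least \<open>y\<close> in the mean and converge to \<open>Y\<close>.\<close>
  define t where "t k = s / real (Suc k)" for k
  have t: "0 < t k" "t k \<le> s" for k
    using \<open>0 < s\<close> by (auto simp: t_def divide_le_eq)
  have lim_t: "t \<longlonglongrightarrow> 0"
    unfolding t_def using LIMSEQ_Suc[OF lim_const_over_n[of s]] by simp
  define h where "h k x = (exp (t k * Y x) - 1) / t k" for k x
  have "(\<lambda>k. expectation (h k)) \<longlonglongrightarrow> expectation Y"
  proof (rule integral_dominated_convergence[where w = "\<lambda>x. \<bar>Y x\<bar> + (exp (s * Y x) + 1) / s"])
    show "AE x in M. (\<lambda>k. h k x) \<longlonglongrightarrow> Y x"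
    proof (rule AE_I2)
      fix x
      have "((\<lambda>u. exp (u * Y x)) has_real_derivative Y x) (at 0)"
        by (auto intro!: derivative_eq_intros)
      then have "((\<lambda>u. (exp (u * Y x) - 1) / u) \<longlongrightarrow> Y x) (at 0)"
        by (simp add: has_field_derivative_iff)
      moreover have "filterlim t (at 0) sequentially"
        using lim_t t(1) by (simp add: filterlim_at less_imp_neq[symmetric])
      ultimately show "(\<lambda>k. h k x) \<longlonglongrightarrow> Y x"
        unfolding h_def by (rule filterlim_compose)
    qed
    show "integrable M (\<lambda>x. \<bar>Y x\<bar> + (exp (s * Y x) + 1) / s)"
      using Y int[of s] \<open>0 < s\<close> by simp
    show "AE x in M. norm (h k x) \<le> \<bar>Y x\<bar> + (exp (s * Y x) + 1) / s" for k
    proof (rule AE_I2)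
      fix x
      have lower: "Y x \<le> h k x"
        using exp_ge_add_one_self[of "t k * Y x"] t(1)[of k] by (simp add: h_def field_simps)
      \<comment> \<open>The point \<open>t k * Y x\<close> is the convex combination of 0 and
        \<open>s * Y x\<close> with weight \<open>t k / s\<close>. The chord thus bounds the
        difference quotient by its value at s, uniformly in k.\<close>
      have "exp (t k * Y x) \<le> (1 - t k / s) + t k / s * exp (s * Y x)"
        using t[of k] \<open>0 < s\<close> convex_onD[OF exp_convex, of "t k / s" 0 "s * Y x"] by simp
      then have "exp (t k * Y x) - 1 \<le> t k * ((exp (s * Y x) - 1) / s)"
        by (simp add: diff_divide_distrib right_diff_distrib)
      then have "h k x \<le> (exp (s * Y x) - 1) / s"
        using t(1)[of k] by (simp add: h_def pos_divide_le_eq mult.commute)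
      also have "\<dots> \<le> (exp (s * Y x) + 1) / s"
        using \<open>0 < s\<close> by (simp add: divide_right_mono)
      finally have "h k x \<le> (exp (s * Y x) + 1) / s" .
      moreover have "0 \<le> (exp (s * Y x) + 1) / s" using \<open>0 < s\<close> by simp
      ultimately show "norm (h k x) \<le> \<bar>Y x\<bar> + (exp (s * Y x) + 1) / s"
        using lower unfolding real_norm_def by linarith
    qed
    show "h k \<in> borel_measurable M" for k unfolding h_def by measurable
  qed simp
  moreover have "y \<le> expectation (h k)" for k
  proof -
    have "t k * y + 1 \<le> exp (t k * y)" using exp_ge_add_one_self[of "t k * y"] by linarith
    also have "\<dots> \<le> expectation (\<lambda>x. exp (t k * Y x))" using ge t by blast
    finally have "y \<le> (expectation (\<lambda>x. exp (t k * Y x)) - 1) / t k"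
      using t(1)[of k] by (simp add: field_simps)
    also have "\<dots> = expectation (h k)"
      using int[OF t[of k]] by (simp add: h_def[abs_def] prob_space)
    finally show ?thesis .
  qed
  ultimately show ?thesis by (intro LIMSEQ_le_const) auto
qed

section \<open>Exponential families with an open parameter set\<close>

locale open_exponential_family =
  fixes lam P0 :: "'a measure" and T :: "'a \<Rightarrow> real ^ 'd" and \<P> :: "'a measure set"
  assumes sigma_finite: "sigma_finite_measure lam"
    and family: "exponential_family lam P0 T \<P>"
    and open_params: "open (canonical_params P0 T \<P>)"
begin

text \<open>The normalizing constant sits in the exponent, so that \<open>- a\<close> is the
  log-normalizer and passing between members is affine in \<open>(\<theta>, a)\<close>. A relation
  is used because P need not determine \<theta>, for instance when the coordinates of T are affinely
  dependent.\<close>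

definition member :: "real ^ 'd \<Rightarrow> real \<Rightarrow> 'a measure \<Rightarrow> bool" where
  "member \<theta> a P \<longleftrightarrow> P \<in> \<P> \<and> P = density P0 (\<lambda>x. ennreal (exp (\<theta> \<bullet> T x + a)))"

lemma exp_tilt_iff:
  "exp_tilt P0 T \<theta> P \<longleftrightarrow> (\<exists>a. P = density P0 (\<lambda>x. ennreal (exp (\<theta> \<bullet> T x + a))))"
proof
  assume "exp_tilt P0 T \<theta> P"
  then obtain c where c: "0 < c" "P = density P0 (\<lambda>x. ennreal (c * exp (\<theta> \<bullet> T x)))"
    unfolding exp_tilt_def by blast
  then have "P = density P0 (\<lambda>x. ennreal (exp (\<theta> \<bullet> T x + ln c)))"
    by (simp add: exp_add mult.commute)
  then show "\<exists>a. P = density P0 (\<lambda>x. ennreal (exp (\<theta> \<bullet> T x + a)))" ..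
next
  assume "\<exists>a. P = density P0 (\<lambda>x. ennreal (exp (\<theta> \<bullet> T x + a)))"
  then obtain a where "P = density P0 (\<lambda>x. ennreal (exp a * exp (\<theta> \<bullet> T x)))"
    by (auto simp: exp_add mult.commute)
  then show "exp_tilt P0 T \<theta> P" unfolding exp_tilt_def by (intro exI[of _ "exp a"]) simp
qed

lemma ex_member: "P \<in> \<P> \<Longrightarrow> \<exists>\<theta> a. member \<theta> a P"
  using family unfolding exponential_family_def exp_tilt_iff member_def by blast

lemma canonical_params_iff: "\<theta> \<in> canonical_params P0 T \<P> \<longleftrightarrow> (\<exists>a P. member \<theta> a P)"
  unfolding canonical_params_def exp_tilt_iff member_def by blast

lemma member_in_family: "member \<theta> a P \<Longrightarrow> P \<in> \<P>"
  unfolding member_def by (rule conjunct1)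

lemma family_dominated: "P \<in> \<P> \<Longrightarrow> P \<in> dominated_probs lam"
  using family by (auto simp: exponential_family_def)

lemma family_sets: "P \<in> \<P> \<Longrightarrow> sets P = sets lam"
  using family_dominated by (auto simp: dominated_probs_def)

lemma family_prob_space: "P \<in> \<P> \<Longrightarrow> prob_space P"
  using family_dominated by (auto simp: dominated_probs_def)

lemma sets_P0: "sets P0 = sets lam"
  using family by (auto simp: exponential_family_def dominated_probs_def)

lemma T_measurable_lam [measurable]: "T \<in> borel_measurable lam"
  using family by (auto simp: exponential_family_def)

lemma T_measurable [measurable]: "sets R = sets lam \<Longrightarrow> T \<in> borel_measurable R"
  using T_measurable_lam by (simp cong: measurable_cong_sets)

lemma T_measurable_P0 [measurable]: "T \<in> borel_measurable P0"
  using sets_P0 by (rule T_measurable)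

text \<open>On a \<open>P0\<close>-null set the density of \<open>P0\<close> vanishes
  \<open>lam\<close>-almost everywhere, while full support makes it positive almost everywhere; so
  the set is \<open>lam\<close>-null.\<close>

lemma base_dominates_lam: "absolutely_continuous P0 lam"
proof -
  interpret sigma_finite_measure lam by (rule sigma_finite)
  have ac: "absolutely_continuous lam P0" and pos: "AE x in lam. 0 < RN_deriv lam P0 x"
    using family by (auto simp: exponential_family_def dominated_probs_def full_support_def)
  have P0: "P0 = density lam (RN_deriv lam P0)"
    using density_RN_deriv[OF ac sets_P0] by simp
  have "N \<in> null_sets lam" if "N \<in> null_sets P0" for N
  proof -
    have "N \<in> null_sets (density lam (RN_deriv lam P0))" using that P0 by simp
    then have "N \<in> sets lam" and "AE x in lam. x \<in> N \<longrightarrow> RN_deriv lam P0 x = 0"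
      by (simp_all add: null_sets_density_iff)
    with pos have "AE x in lam. x \<notin> N" by (auto elim: AE_mp)
    then show ?thesis using \<open>N \<in> sets lam\<close> by (simp add: AE_iff_null_sets)
  qed
  then show ?thesis by (auto simp: absolutely_continuous_def)
qed

text \<open>An exponential density never vanishes, so P-null sets are null for \<open>P0\<close>,
  then for \<open>lam\<close>, then for R. Consequently \<open>KL R P\<close> can be infinite only
  through non-integrability.\<close>

lemma family_dominates:
  assumes "P \<in> \<P>" "R \<in> dominated_probs lam"
  shows "absolutely_continuous P R"
proof -
  obtain \<theta> a where P: "P = density P0 (\<lambda>x. ennreal (exp (\<theta> \<bullet> T x + a)))"
    using ex_member[OF assms(1)] by (auto simp: member_def)
  have "null_sets P \<subseteq> null_sets P0"
    unfolding P by (auto simp: null_sets_density_iff AE_iff_null_sets[symmetric])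
  with base_dominates_lam assms(2) show ?thesis
    by (auto simp: absolutely_continuous_def dominated_probs_def)
qed

lemma member_density:
  assumes "member \<theta> a P" "member \<theta>' a' P'"
  shows "P' = density P (\<lambda>x. ennreal (exp ((\<theta>' - \<theta>) \<bullet> T x + (a' - a))))"
proof -
  have "density P (\<lambda>x. ennreal (exp ((\<theta>' - \<theta>) \<bullet> T x + (a' - a)))) =
      density P0 (\<lambda>x. ennreal (exp (\<theta> \<bullet> T x + a)) * ennreal (exp ((\<theta>' - \<theta>) \<bullet> T x + (a' - a))))"
    using assms(1) by (auto simp: member_def intro!: density_density_eq)
  also have "\<dots> = density P0 (\<lambda>x. ennreal (exp (\<theta>' \<bullet> T x + a')))"
    by (simp add: ennreal_mult[symmetric] exp_add[symmetric] inner_diff_left)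
  finally show ?thesis using assms(2) by (simp add: member_def)
qed

text \<open>The density of P' with respect to P is \<open>exp (\<delta> \<bullet> T x)\<close> up to
  the factor \<open>exp (a' - a)\<close>, and P' has total mass 1. Moments of T under a member are
  thereby read off from the normalizers.\<close>

lemma exp_moment:
  assumes m: "member \<theta> a P" "member (\<theta> + \<delta>) a' P'"
  shows "(\<integral>\<^sup>+x. ennreal (exp (\<delta> \<bullet> T x)) \<partial>P) = ennreal (exp (a - a'))"
proof -
  have [measurable]: "T \<in> borel_measurable P"
    using m(1) by (intro T_measurable family_sets member_in_family)
  interpret P': prob_space P' using m(2) by (intro family_prob_space member_in_family)
  have "ennreal (exp (a - a')) * 1 =
      ennreal (exp (a - a')) * emeasure (density P (\<lambda>x. ennreal (exp (\<delta> \<bullet> T x + (a' - a))))) (space P)"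
    using P'.emeasure_space_1 member_density[OF m] by simp
  also have "\<dots> = (\<integral>\<^sup>+x. ennreal (exp (a - a')) * ennreal (exp (\<delta> \<bullet> T x + (a' - a))) \<partial>P)"
    by (subst emeasure_density) (auto simp: nn_integral_cmult cong: nn_integral_cong)
  also have "\<dots> = (\<integral>\<^sup>+x. ennreal (exp (\<delta> \<bullet> T x)) \<partial>P)"
    by (simp add: ennreal_mult[symmetric] exp_add[symmetric])
  finally show ?thesis by simp
qed

text \<open>Openness of the parameter set enters here: every small perturbation of a parameter is
  again realized by a member of the family.\<close>

lemma nearby_members:
  assumes "member \<theta> a P"
  obtains \<epsilon> where "0 < \<epsilon>" "\<And>\<delta>. norm \<delta> \<le> \<epsilon> \<Longrightarrow> \<exists>a' P'. member (\<theta> + \<delta>) a' P'"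
proof -
  have "\<theta> \<in> canonical_params P0 T \<P>" using assms canonical_params_iff by blast
  with open_params obtain \<epsilon> where \<epsilon>: "0 < \<epsilon>" "cball \<theta> \<epsilon> \<subseteq> canonical_params P0 T \<P>"
    using open_contains_cball by blast
  show ?thesis
  proof (rule that[OF \<epsilon>(1)])
    fix \<delta> :: "real ^ 'd" assume "norm \<delta> \<le> \<epsilon>"
    then have "\<theta> + \<delta> \<in> cball \<theta> \<epsilon>" by (simp add: dist_norm)
    then show "\<exists>a' P'. member (\<theta> + \<delta>) a' P'" using \<epsilon>(2) canonical_params_iff by blast
  qed
qed

text \<open>The entropy bound is applied to each coordinate of \<open>\<epsilon> * T\<close>, whose
  exponential moments are finite because \<theta> can be moved by \<epsilon> in both directions
  along every axis. K and C do not depend on R, so the bound can later be integrated over a random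
  R.\<close>

lemma nn_integral_norm_T_le:
  assumes "P \<in> \<P>"
  obtains K C :: real where "0 < K" "0 \<le> C"
    "\<And>R. R \<in> dominated_probs lam \<Longrightarrow>
       (\<integral>\<^sup>+x. ennreal (norm (T x)) \<partial>R) \<le> ennreal K * KL R P + ennreal C"
proof -
  obtain \<theta> a where m: "member \<theta> a P" using ex_member[OF assms] by blast
  obtain \<epsilon> where \<epsilon>: "0 < \<epsilon>" "\<And>\<delta>. norm \<delta> \<le> \<epsilon> \<Longrightarrow> \<exists>a' P'. member (\<theta> + \<delta>) a' P'"
    using nearby_members[OF m] by blast
  have [measurable]: "T \<in> borel_measurable P"
    using assms by (intro T_measurable family_sets)
  have [measurable]: "(\<lambda>x. T x $ i) \<in> borel_measurable P" for i
    unfolding cart_eq_inner_axis by measurable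
  define c where "c i = enn2real (\<integral>\<^sup>+x. ennreal (exp \<bar>\<epsilon> * T x $ i\<bar>) \<partial>P)" for i
  have fin: "(\<integral>\<^sup>+x. ennreal (exp \<bar>\<epsilon> * T x $ i\<bar>) \<partial>P) < \<infinity>" for i
  proof -
    define \<delta> :: "real ^ 'd" where "\<delta> = \<epsilon> *\<^sub>R axis i 1"
    have \<delta>: "\<delta> \<bullet> T x = \<epsilon> * T x $ i" "norm \<delta> \<le> \<epsilon>" for x
      using \<epsilon>(1) by (simp_all add: \<delta>_def inner_axis' norm_axis_1)
    obtain a1 P1 a2 P2 where m12: "member (\<theta> + \<delta>) a1 P1" "member (\<theta> + - \<delta>) a2 P2"
      using \<epsilon>(2)[of \<delta>] \<epsilon>(2)[of "- \<delta>"] \<delta> by auto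
    have "(\<integral>\<^sup>+x. ennreal (exp \<bar>\<epsilon> * T x $ i\<bar>) \<partial>P)
        \<le> (\<integral>\<^sup>+x. ennreal (exp (\<delta> \<bullet> T x)) + ennreal (exp (- \<delta> \<bullet> T x)) \<partial>P)"
      by (intro nn_integral_mono) (auto simp: \<delta> abs_if ennreal_plus[symmetric] simp del: ennreal_plus)
    also have "\<dots> = ennreal (exp (a - a1)) + ennreal (exp (a - a2))"
      using exp_moment[OF m m12(1)] exp_moment[OF m m12(2)] by (simp add: nn_integral_add)
    also have "\<dots> < \<infinity>" by simp
    finally show ?thesis .
  qed
  have c: "(\<integral>\<^sup>+x. ennreal (exp \<bar>\<epsilon> * T x $ i\<bar>) \<partial>P) = ennreal (c i)" "0 \<le> c i" for i
    using fin[of i] by (simp_all add: c_def)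
  show ?thesis
  \<comment> \<open>Dividing the coordinate bounds \<open>KL R P + c i\<close> by \<epsilon> and
    summing them, as the l1 norm dominates the Euclidean norm, gives these two constants.\<close>
  proof (rule that[of "real CARD('d) / \<epsilon>" "(\<Sum>i\<in>UNIV. c i) / \<epsilon>"])
    fix R assume R: "R \<in> dominated_probs lam"
    then have sets: "sets R = sets lam" and "prob_space R" by (auto simp: dominated_probs_def)
    have [measurable]: "T \<in> borel_measurable R" using sets by (rule T_measurable)
    have [measurable]: "(\<lambda>x. T x $ i) \<in> borel_measurable R" for i
      unfolding cart_eq_inner_axis by measurable
    have *: "(\<integral>\<^sup>+x. ennreal \<bar>\<epsilon> * T x $ i\<bar> \<partial>R) \<le> KL R P + ennreal (c i)" for i
      unfolding c(1)[symmetric]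
      by (rule nn_integral_abs_le_KL[OF family_prob_space[OF assms] \<open>prob_space R\<close>
            family_dominates[OF assms R]]) (simp_all add: sets family_sets[OF assms])
    have "(\<integral>\<^sup>+x. ennreal (norm (T x)) \<partial>R)
        \<le> (\<integral>\<^sup>+x. ennreal (1 / \<epsilon>) * (\<Sum>i\<in>UNIV. ennreal \<bar>\<epsilon> * T x $ i\<bar>) \<partial>R)"
      using \<epsilon>(1) norm_le_l1_cart[of "T _"]
      by (intro nn_integral_mono)
         (auto simp: ennreal_mult[symmetric] sum_nonneg abs_mult sum_distrib_left[symmetric])
    also have "\<dots> = ennreal (1 / \<epsilon>) * (\<Sum>i\<in>UNIV. \<integral>\<^sup>+x. ennreal \<bar>\<epsilon> * T x $ i\<bar> \<partial>R)"
      by (subst nn_integral_cmult, simp, subst nn_integral_sum) simp_all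
    also have "\<dots> \<le> ennreal (1 / \<epsilon>) * (\<Sum>i\<in>(UNIV :: 'd set). KL R P + ennreal (c i))"
      by (intro mult_left_mono sum_mono *) auto
    also have "\<dots> = ennreal (real CARD('d) / \<epsilon>) * KL R P + ennreal ((\<Sum>i\<in>UNIV. c i) / \<epsilon>)"
      using \<epsilon>(1) c(2)
      by (simp add: sum.distrib distrib_left ennreal_mult[symmetric] sum_nonneg
          ennreal_of_nat_eq_real_of_nat mult.assoc[symmetric])
    finally show "(\<integral>\<^sup>+x. ennreal (norm (T x)) \<partial>R)
        \<le> ennreal (real CARD('d) / \<epsilon>) * KL R P + ennreal ((\<Sum>i\<in>UNIV. c i) / \<epsilon>)" .
  qed (use \<epsilon>(1) c(2) in \<open>auto intro!: divide_nonneg_pos sum_nonneg\<close>)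
qed

lemma integrable_T:
  assumes "P \<in> \<P>" "R \<in> dominated_probs lam" "KL R P < \<infinity>"
  shows "integrable R T"
proof -
  obtain K C :: real where "(\<integral>\<^sup>+x. ennreal (norm (T x)) \<partial>R) \<le> ennreal K * KL R P + ennreal C"
    using nn_integral_norm_T_le[OF assms(1)] assms(2) by metis
  also have "\<dots> < \<infinity>" using assms(3) by (simp add: ennreal_mult_less_top)
  finally show ?thesis
    using assms(2) by (intro integrableI_bounded T_measurable) (auto simp: dominated_probs_def)
qed

lemma KL_self: "P \<in> \<P> \<Longrightarrow> KL P P = 0"
proof -
  assume P: "P \<in> \<P>"
  interpret prob_space P using P by (rule family_prob_space)
  have "AE x in P. 1 = RN_deriv P P x"
    by (rule RN_deriv_unique) (simp_all add: density_1)
  then have "integrable P (entropy_density (exp 1) P P) \<longleftrightarrow> integrable P (\<lambda>_. 0 :: real)"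
    by (intro integrable_cong_AE) (auto simp: entropy_density_def elim: AE_mp)
  then show ?thesis
    using KL_same_eq_0[of "exp 1"] by (simp add: KL_def absolutely_continuous_def)
qed

text \<open>This is \<open>KL_tilt\<close> with an exponent affine in T, which integrates to an
  expression in the mean of T alone. Finiteness relative to one member therefore spreads to all
  members.\<close>

lemma KL_shift:
  assumes "R \<in> dominated_probs lam" and m: "member \<theta> a P" "member \<theta>' a' P'" and fin: "KL R P < \<infinity>"
  shows "KL R P' < \<infinity>"
    and "enn2real (KL R P') = enn2real (KL R P) - ((\<theta>' - \<theta>) \<bullet> mean_stat T R + (a' - a))"
proof -
  note in_family = m[THEN member_in_family]
  have R: "prob_space R" "sets R = sets lam" using assms(1) by (auto simp: dominated_probs_def)
  interpret R: prob_space R by fact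
  have int: "integrable R T" using in_family(1) assms(1) fin by (rule integrable_T)
  have [measurable]: "T \<in> borel_measurable P" using in_family(1) by (intro T_measurable family_sets)
  note KL_tilt = KL_tilt[where R = R, OF family_prob_space[OF in_family(1)]
      family_prob_space[OF in_family(2)] R(1) family_dominates[OF in_family(1) assms(1)]
      family_dominates[OF in_family(2) assms(1)] _ _ member_density[OF m] _ fin]
  show "KL R P' < \<infinity>"
    using int R(2) family_sets[OF in_family(1)] by (intro KL_tilt(1)) auto
  have "enn2real (KL R P') = enn2real (KL R P) - (\<integral>x. (\<theta>' - \<theta>) \<bullet> T x + (a' - a) \<partial>R)"
    using int R(2) family_sets[OF in_family(1)] by (intro KL_tilt(2)) auto
  also have "(\<integral>x. (\<theta>' - \<theta>) \<bullet> T x + (a' - a) \<partial>R) = (\<theta>' - \<theta>) \<bullet> mean_stat T R + (a' - a)"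
    using int by (simp add: mean_stat_def R.prob_space)
  finally show "enn2real (KL R P') = enn2real (KL R P) - ((\<theta>' - \<theta>) \<bullet> mean_stat T R + (a' - a))" .
qed

text \<open>Put R = P in \<open>KL_shift\<close> and use \<open>KL P P = 0\<close>. The inequality
  says that the parameters of P maximize \<open>\<theta>' \<bullet> \<mu> + a'\<close> over the
  family when \<mu> is the mean of T under P.\<close>

lemma KL_members:
  assumes "member \<theta> a P" "member \<theta>' a' P'"
  shows "KL P P' = ennreal ((\<theta> - \<theta>') \<bullet> mean_stat T P + (a - a'))"
    and "0 \<le> (\<theta> - \<theta>') \<bullet> mean_stat T P + (a - a')"
proof -
  note P = member_in_family[OF assms(1)]
  have "KL P P' < \<infinity>" and "enn2real (KL P P') = (\<theta> - \<theta>') \<bullet> mean_stat T P + (a - a')"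
    using KL_shift[OF family_dominated[OF P] assms] KL_self[OF P] by (simp_all add: inner_diff_left)
  then show "KL P P' = ennreal ((\<theta> - \<theta>') \<bullet> mean_stat T P + (a - a'))"
    and "0 \<le> (\<theta> - \<theta>') \<bullet> mean_stat T P + (a - a')"
    by (metis ennreal_enn2real infinity_ennreal_def, metis enn2real_nonneg)
qed

text \<open>Since \<open>- a'\<close> is the log-normalizer, this is its Legendre conjugate at
  \<mu>, taken over the family, minus the value \<open>\<theta> \<bullet> \<mu> + a\<close>. It
  expresses the divergence through the mean parameter without selecting canonical
  parameters.\<close>

definition KL_dual :: "real ^ 'd \<Rightarrow> real \<Rightarrow> real ^ 'd \<Rightarrow> ennreal" where
  "KL_dual \<theta> a \<mu> = (SUP (\<theta>', a') \<in> {(\<theta>', a'). \<exists>P'. member \<theta>' a' P'}.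
     ennreal ((\<theta>' - \<theta>) \<bullet> \<mu> + (a' - a)))"

text \<open>The supremum is uncountable, but lower semicontinuous in \<open>\<mu>\<close>.\<close>

lemma KL_dual_measurable [measurable]: "KL_dual \<theta> a \<in> borel_measurable borel"
proof (rule borel_measurableI_greater)
  fix y
  have "{\<mu> \<in> space borel. y < KL_dual \<theta> a \<mu>} =
      (\<Union>(\<theta>', a') \<in> {(\<theta>', a'). \<exists>P'. member \<theta>' a' P'}. {\<mu>. y < ennreal ((\<theta>' - \<theta>) \<bullet> \<mu> + (a' - a))})"
    by (auto simp: KL_dual_def less_SUP_iff)
  also have "open \<dots>"
    by (intro open_UN ballI) (auto intro!: open_Collect_less continuous_intros continuous_on_ennreal)
  finally show "{\<mu> \<in> space borel. y < KL_dual \<theta> a \<mu>} \<in> sets borel" by simp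
qed

text \<open>The supremum is attained at the parameters of Q: replacing them by those of another
  member P' loses exactly the nonnegative amount \<open>KL Q P'\<close>.\<close>

lemma KL_eq_dual:
  assumes "Q \<in> \<P>" "member \<theta> a P"
  shows "KL Q P = KL_dual \<theta> a (mean_stat T Q)"
proof -
  obtain \<theta>\<^sub>0 a\<^sub>0 where Q: "member \<theta>\<^sub>0 a\<^sub>0 Q" using ex_member[OF assms(1)] by blast
  show ?thesis
    unfolding KL_dual_def KL_members(1)[OF Q assms(2)]
  proof (rule antisym)
    show "ennreal ((\<theta>\<^sub>0 - \<theta>) \<bullet> mean_stat T Q + (a\<^sub>0 - a))
        \<le> (SUP (\<theta>', a') \<in> {(\<theta>', a'). \<exists>P'. member \<theta>' a' P'}. ennreal ((\<theta>' - \<theta>) \<bullet> mean_stat T Q + (a' - a)))"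
      using Q by (intro SUP_upper2[of "(\<theta>\<^sub>0, a\<^sub>0)"]) auto
    show "(SUP (\<theta>', a') \<in> {(\<theta>', a'). \<exists>P'. member \<theta>' a' P'}. ennreal ((\<theta>' - \<theta>) \<bullet> mean_stat T Q + (a' - a)))
        \<le> ennreal ((\<theta>\<^sub>0 - \<theta>) \<bullet> mean_stat T Q + (a\<^sub>0 - a))"
      using KL_members(2)[OF Q]
      by (intro SUP_least) (force simp: inner_diff_left intro!: ennreal_leI)
  qed
qed

end

section \<open>Random distributions, the first-order condition and the Pythagorean identity\<close>

locale random_distribution = open_exponential_family lam P0 T \<P> + prob_space M
  for lam P0 :: "'a measure" and T :: "'a \<Rightarrow> real ^ 'd" and \<P> and M :: "'w measure" +
  fixes Rv :: "'w \<Rightarrow> 'a measure"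
  assumes Rv_measurable: "Rv \<in> M \<rightarrow>\<^sub>M prob_algebra lam"
    and Rv_dominated: "\<omega> \<in> space M \<Longrightarrow> Rv \<omega> \<in> dominated_probs lam"
    and KL_measurable: "P \<in> \<P> \<Longrightarrow> (\<lambda>\<omega>. KL (Rv \<omega>) P) \<in> borel_measurable M"
begin

definition overall_mean :: "real ^ 'd" where
  "overall_mean = (\<integral>\<omega>. mean_stat T (Rv \<omega>) \<partial>M)"

lemma AE_KL_finite:
  assumes "P \<in> \<P>" "mean_KL M Rv P < \<infinity>"
  shows "AE \<omega> in M. KL (Rv \<omega>) P < \<infinity>"
  using nn_integral_PInf_AE[OF KL_measurable[OF assms(1)]] assms(2)
  by (auto simp: mean_KL_def less_top)

lemma AE_integrable_T:
  assumes "P \<in> \<P>" "mean_KL M Rv P < \<infinity>"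
  shows "AE \<omega> in M. integrable (Rv \<omega>) T"
  using AE_KL_finite[OF assms] AE_space
  by eventually_elim (rule integrable_T[OF assms(1) Rv_dominated])

lemma mean_stat_measurable: "(\<lambda>\<omega>. mean_stat T (Rv \<omega>)) \<in> borel_measurable M"
  unfolding mean_stat_def
  by (rule measurable_compose[OF measurable_prob_algebraD[OF Rv_measurable]
        integral_measurable_subprob_algebra[OF T_measurable_lam]])

text \<open>The bound of \<open>nn_integral_norm_T_le\<close> is affine in the divergence with
  constants uniform in R, so integrating it over \<omega> leaves a finite quantity.\<close>

lemma integrable_mean_stat:
  assumes "P \<in> \<P>" "mean_KL M Rv P < \<infinity>"
  shows "integrable M (\<lambda>\<omega>. mean_stat T (Rv \<omega>))"
proof (rule integrableI_bounded[OF mean_stat_measurable])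
  obtain K C :: real where KC: "0 < K" "0 \<le> C" "\<And>R. R \<in> dominated_probs lam \<Longrightarrow>
       (\<integral>\<^sup>+x. ennreal (norm (T x)) \<partial>R) \<le> ennreal K * KL R P + ennreal C"
    using nn_integral_norm_T_le[OF assms(1)] by metis
  have "(\<integral>\<^sup>+\<omega>. ennreal (norm (mean_stat T (Rv \<omega>))) \<partial>M) \<le> (\<integral>\<^sup>+\<omega>. ennreal K * KL (Rv \<omega>) P + ennreal C \<partial>M)"
  proof (rule nn_integral_mono_AE)
    show "AE \<omega> in M. ennreal (norm (mean_stat T (Rv \<omega>))) \<le> ennreal K * KL (Rv \<omega>) P + ennreal C"
      using AE_integrable_T[OF assms] AE_space
    proof eventually_elim
      case (elim \<omega>)
      then show ?case
        unfolding mean_stat_def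
        using integral_norm_bound_ennreal KC(3)[OF Rv_dominated] order_trans by blast
    qed
  qed
  also have "\<dots> = ennreal K * mean_KL M Rv P + ennreal C"
    using KL_measurable[OF assms(1)]
    by (simp add: nn_integral_add nn_integral_cmult mean_KL_def emeasure_space_1)
  also have "\<dots> < \<infinity>" using assms(2) by (simp add: ennreal_mult_less_top)
  finally show "(\<integral>\<^sup>+\<omega>. ennreal (norm (mean_stat T (Rv \<omega>))) \<partial>M) < \<infinity>" .
qed

lemma mean_KL_eq_integral:
  assumes "P \<in> \<P>" "mean_KL M Rv P < \<infinity>"
  shows "integrable M (\<lambda>\<omega>. enn2real (KL (Rv \<omega>) P))"
    and "enn2real (mean_KL M Rv P) = (\<integral>\<omega>. enn2real (KL (Rv \<omega>) P) \<partial>M)"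
proof -
  note [measurable] = KL_measurable[OF assms(1)]
  have eq: "mean_KL M Rv P = (\<integral>\<^sup>+\<omega>. ennreal (enn2real (KL (Rv \<omega>) P)) \<partial>M)"
    unfolding mean_KL_def
    by (intro nn_integral_cong_AE) (use AE_KL_finite[OF assms] in eventually_elim, simp)
  show "integrable M (\<lambda>\<omega>. enn2real (KL (Rv \<omega>) P))"
    using assms(2) by (intro integrableI_nonneg) (auto simp: eq)
  then show "enn2real (mean_KL M Rv P) = (\<integral>\<omega>. enn2real (KL (Rv \<omega>) P) \<partial>M)"
    unfolding eq by (subst nn_integral_eq_integral) auto
qed

text \<open>This integrates \<open>KL_shift\<close> over \<omega>. Minimizing the mean divergence
  over the family thus amounts to maximizing
  \<open>\<theta>' \<bullet> overall_mean + a'\<close>.\<close>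

lemma mean_KL_shift:
  assumes m: "member \<theta> a P" "member \<theta>' a' P'" and fin: "mean_KL M Rv P < \<infinity>"
  shows "mean_KL M Rv P' < \<infinity>"
    and "enn2real (mean_KL M Rv P') =
      enn2real (mean_KL M Rv P) - ((\<theta>' - \<theta>) \<bullet> overall_mean + (a' - a))"
proof -
  note in_family = m[THEN member_in_family]
  note int = integrable_mean_stat[OF in_family(1) fin]
  note KL_int = mean_KL_eq_integral[OF in_family(1) fin]
  let ?k = "\<lambda>\<omega>. enn2real (KL (Rv \<omega>) P) - ((\<theta>' - \<theta>) \<bullet> mean_stat T (Rv \<omega>) + (a' - a))"
  have ae: "AE \<omega> in M. KL (Rv \<omega>) P' < \<infinity> \<and> enn2real (KL (Rv \<omega>) P') = ?k \<omega>"
    using AE_KL_finite[OF in_family(1) fin] AE_space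
    by eventually_elim (use KL_shift[OF Rv_dominated m] in blast)
  have int_k: "integrable M ?k" using int KL_int(1) by simp
  have "mean_KL M Rv P' = (\<integral>\<^sup>+\<omega>. ennreal (?k \<omega>) \<partial>M)"
    unfolding mean_KL_def
    by (intro nn_integral_cong_AE) (use ae in eventually_elim, metis ennreal_enn2real infinity_ennreal_def)
  also have "\<dots> < \<infinity>"
    using int_k by (simp add: integrable_iff_bounded order_le_less_trans[OF nn_integral_mono[OF ennreal_leI[OF abs_ge_self]]])
  finally show fin': "mean_KL M Rv P' < \<infinity>" .
  have [measurable]: "(\<lambda>\<omega>. KL (Rv \<omega>) P') \<in> borel_measurable M" using in_family(2) by (rule KL_measurable)
  have "enn2real (mean_KL M Rv P') = (\<integral>\<omega>. ?k \<omega> \<partial>M)"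
    unfolding mean_KL_eq_integral(2)[OF in_family(2) fin']
    by (rule integral_cong_AE) (use ae int_k in auto)
  also have "\<dots> = enn2real (mean_KL M Rv P) - ((\<theta>' - \<theta>) \<bullet> overall_mean + (a' - a))"
    using int KL_int by (simp add: prob_space overall_mean_def)
  finally show "enn2real (mean_KL M Rv P') =
      enn2real (mean_KL M Rv P) - ((\<theta>' - \<theta>) \<bullet> overall_mean + (a' - a))" .
qed

text \<open>If the means differed, the parameter of Q could be moved along their difference d.
  Minimality and \<open>mean_KL_shift\<close> bound \<open>t * (d \<bullet> overall_mean)\<close> by
  \<open>a - a'\<close>, the logarithm of the exponential moment of
  \<open>t * (d \<bullet> T x)\<close> under Q. Letting t tend to 0 gives
  \<open>d \<bullet> d \<le> 0\<close>.\<close>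

lemma mean_stat_arg_min:
  assumes min: "is_arg_min (mean_KL M Rv) (\<lambda>P. P \<in> \<P>) Q" and fin: "mean_KL M Rv Q < \<infinity>"
  shows "mean_stat T Q = overall_mean"
proof (rule ccontr)
  assume ne: "mean_stat T Q \<noteq> overall_mean"
  have Q: "Q \<in> \<P>" and le: "\<And>P. P \<in> \<P> \<Longrightarrow> mean_KL M Rv Q \<le> mean_KL M Rv P"
    using min by (auto simp: is_arg_min_linorder)
  interpret Q: prob_space Q using Q by (rule family_prob_space)
  obtain \<theta> a where m: "member \<theta> a Q" using ex_member[OF Q] by blast
  obtain \<epsilon> where \<epsilon>: "0 < \<epsilon>" "\<And>\<delta>. norm \<delta> \<le> \<epsilon> \<Longrightarrow> \<exists>a' P'. member (\<theta> + \<delta>) a' P'"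
    using nearby_members[OF m] by blast
  have int: "integrable Q T" using integrable_T[OF Q family_dominated[OF Q]] KL_self[OF Q] by simp
  have [measurable]: "T \<in> borel_measurable Q" using int by auto
  define d where "d = overall_mean - mean_stat T Q"
  \<comment> \<open>For \<open>t \<le> s\<close> the shift \<open>t *\<^sub>R d\<close> has norm at
    most \<epsilon>, so the perturbed parameter still belongs to a member.\<close>
  define s where "s = \<epsilon> / norm d"
  have "0 < norm d" using ne by (simp add: d_def)
  then have s: "0 < s" "s * norm d = \<epsilon>" using \<epsilon>(1) by (simp_all add: s_def)
  have *: "integrable Q (\<lambda>x. exp (t * (d \<bullet> T x))) \<and>
      exp (t * (d \<bullet> overall_mean)) \<le> (\<integral>x. exp (t * (d \<bullet> T x)) \<partial>Q)" if t: "0 < t" "t \<le> s" for t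
  proof -
    have "norm (t *\<^sub>R d) \<le> \<epsilon>"
      using t s(2) by (metis abs_of_pos mult_right_mono norm_ge_zero norm_scaleR)
    then obtain a' P' where m': "member (\<theta> + t *\<^sub>R d) a' P'" using \<epsilon>(2) by blast
    have eq: "(\<integral>\<^sup>+x. ennreal (exp (t * (d \<bullet> T x))) \<partial>Q) = ennreal (exp (a - a'))"
      using exp_moment[OF m m'] by simp
    have i: "integrable Q (\<lambda>x. exp (t * (d \<bullet> T x)))"
      by (rule integrableI_nonneg) (auto simp: eq)
    have "(\<integral>x. exp (t * (d \<bullet> T x)) \<partial>Q) = exp (a - a')"
      using eq by (intro integral_eq_nn_integral[THEN trans]) auto
    moreover have "enn2real (mean_KL M Rv Q) \<le> enn2real (mean_KL M Rv P')"
      using le[OF member_in_family[OF m']] mean_KL_shift(1)[OF m m' fin]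
      by (intro enn2real_mono) auto
    then have "t * (d \<bullet> overall_mean) \<le> a - a'"
      using mean_KL_shift(2)[OF m m' fin] by simp
    ultimately show ?thesis using i by simp
  qed
  have "d \<bullet> overall_mean \<le> (\<integral>x. d \<bullet> T x \<partial>Q)"
    by (rule Q.expectation_ge_of_exp_moments[OF _ s(1)]) (use int * in auto)
  also have "\<dots> = d \<bullet> mean_stat T Q" using int by (simp add: mean_stat_def)
  finally have "d \<bullet> d \<le> 0" by (simp add: d_def inner_diff_right)
  with \<open>0 < norm d\<close> show False by (metis inner_gt_zero_iff not_le zero_less_norm_iff)
qed

text \<open>The shift of the mean divergence from Q to P and the divergence \<open>KL Q P\<close>
  are the same affine expression, evaluated at \<open>overall_mean\<close> and at the mean of Q
  respectively; these points coincide.\<close>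

lemma pythagoras:
  assumes min: "is_arg_min (mean_KL M Rv) (\<lambda>P. P \<in> \<P>) Q" and fin: "mean_KL M Rv Q < \<infinity>"
    and P: "P \<in> \<P>"
  shows "mean_KL M Rv P = KL Q P + mean_KL M Rv Q"
proof -
  have "Q \<in> \<P>" using min by (simp add: is_arg_min_linorder)
  then obtain \<theta> a \<theta>' a' where m: "member \<theta> a Q" "member \<theta>' a' P"
    using ex_member[of Q] ex_member[OF P] by blast
  note shift = mean_KL_shift[OF m fin]
  note KL = KL_members[OF m, unfolded mean_stat_arg_min[OF min fin]]
  have "mean_KL M Rv P = ennreal (enn2real (mean_KL M Rv P))" using shift(1) by simp
  also have "\<dots> = ennreal (((\<theta> - \<theta>') \<bullet> overall_mean + (a - a')) + enn2real (mean_KL M Rv Q))"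
    unfolding shift(2) by (simp add: inner_diff_left algebra_simps)
  also have "\<dots> = KL Q P + mean_KL M Rv Q"
    using KL fin by (simp add: ennreal_plus)
  finally show ?thesis .
qed

end

lemma dist_mean_is_arg_min:
  assumes "dist_mean_exists \<P> M Rv"
  shows "is_arg_min (mean_KL M Rv) (\<lambda>P. P \<in> \<P>) (dist_mean \<P> M Rv)"
  using assms unfolding dist_mean_exists_def dist_mean_def arg_min_def by (rule someI_ex)

lemma dist_var_eq_mean_KL:
  assumes "is_arg_min (mean_KL M Rv) (\<lambda>P. P \<in> \<P>) Q"
  shows "dist_var \<P> M Rv = mean_KL M Rv Q"
  unfolding dist_var_def using assms
  by (intro antisym INF_lower INF_greatest) (auto simp: is_arg_min_linorder)


section \<open>Conditioning on a statistic\<close>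

context open_exponential_family
begin

text \<open>By \<open>law\<close>, the law of Y is the mixture of the kernels, so the mean
  divergence is the mean of its conditional versions, each of which splits by
  \<open>pythagoras\<close>. The member Q of finite mean divergence is a reference that keeps almost
  all conditional quantities finite.\<close>

lemma mean_KL_disintegrate:
  fixes Y :: "'w \<Rightarrow> 'y" and S :: "'w \<Rightarrow> 's"
  assumes "prob_space M"
    and Y [measurable]: "Y \<in> M \<rightarrow>\<^sub>M N" and S [measurable]: "S \<in> M \<rightarrow>\<^sub>M B"
    and \<kappa>: "\<kappa> \<in> B \<rightarrow>\<^sub>M prob_algebra N"
    and law: "\<And>A. A \<in> sets N \<Longrightarrow> emeasure (distr M N Y) A = (\<integral>\<^sup>+s. emeasure (\<kappa> s) A \<partial>distr M B S)"
    and R: "R \<in> N \<rightarrow>\<^sub>M prob_algebra lam" "\<And>y. y \<in> space N \<Longrightarrow> R y \<in> dominated_probs lam"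
      "\<And>P. P \<in> \<P> \<Longrightarrow> (\<lambda>y. KL (R y) P) \<in> borel_measurable N"
    and ex: "AE s in distr M B S. dist_mean_exists \<P> (\<kappa> s) R"
    and Q: "Q \<in> \<P>" "mean_KL M (\<lambda>\<omega>. R (Y \<omega>)) Q < \<infinity>"
    and P: "P \<in> \<P>"
  shows "mean_KL M (\<lambda>\<omega>. R (Y \<omega>)) P =
    mean_KL M (\<lambda>\<omega>. dist_mean \<P> (\<kappa> (S \<omega>)) R) P + (\<integral>\<^sup>+\<omega>. dist_var \<P> (\<kappa> (S \<omega>)) R \<partial>M)"
proof -
  interpret M: prob_space M by fact
  let ?q = "\<lambda>\<omega>. dist_mean \<P> (\<kappa> (S \<omega>)) R" and ?v = "\<lambda>\<omega>. dist_var \<P> (\<kappa> (S \<omega>)) R"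
  define \<mu> where "\<mu> s = (\<integral>y. mean_stat T (R y) \<partial>\<kappa> s)" for s
  have \<kappa>' [measurable]: "\<kappa> \<in> B \<rightarrow>\<^sub>M subprob_algebra N" using \<kappa> by (rule measurable_prob_algebraD)
  have R': "R \<in> N \<rightarrow>\<^sub>M subprob_algebra lam" using R(1) by (rule measurable_prob_algebraD)
  have ne: "space (distr M B S) \<noteq> {}"
    using measurable_space[OF S] M.not_empty by auto
  have \<kappa>_distr: "\<kappa> \<in> distr M B S \<rightarrow>\<^sub>M subprob_algebra N" by simp
  have distr_Y: "distr M N Y = distr M B S \<bind> \<kappa>"
  proof (rule measure_eqI)
    show "sets (distr M N Y) = sets (distr M B S \<bind> \<kappa>)"
      by (simp only: sets_distr sets_bind_measurable[OF \<kappa>_distr ne])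
    fix A assume "A \<in> sets (distr M N Y)"
    then have A: "A \<in> sets N" by simp
    show "emeasure (distr M N Y) A = emeasure (distr M B S \<bind> \<kappa>) A"
      unfolding law[OF A] by (rule emeasure_bind[OF ne \<kappa>_distr A, symmetric])
  qed
  have KL_total: "mean_KL M (\<lambda>\<omega>. R (Y \<omega>)) P' = (\<integral>\<^sup>+\<omega>. mean_KL (\<kappa> (S \<omega>)) R P' \<partial>M)"
    and [measurable]: "(\<lambda>s. mean_KL (\<kappa> s) R P') \<in> borel_measurable B" if "P' \<in> \<P>" for P'
  proof -
    note [measurable] = R(3)[OF that]
    show [measurable]: "(\<lambda>s. mean_KL (\<kappa> s) R P') \<in> borel_measurable B"
      unfolding mean_KL_def
      by (rule measurable_compose[OF \<kappa>' nn_integral_measurable_subprob_algebra[OF R(3)[OF that]]])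
    have "mean_KL M (\<lambda>\<omega>. R (Y \<omega>)) P' = (\<integral>\<^sup>+y. KL (R y) P' \<partial>distr M N Y)"
      unfolding mean_KL_def by (subst nn_integral_distr) auto
    also have "\<dots> = (\<integral>\<^sup>+s. mean_KL (\<kappa> s) R P' \<partial>distr M B S)"
      unfolding distr_Y mean_KL_def by (rule nn_integral_bind[where B = N]) auto
    also have "\<dots> = (\<integral>\<^sup>+\<omega>. mean_KL (\<kappa> (S \<omega>)) R P' \<partial>M)"
      by (rule nn_integral_distr) auto
    finally show "mean_KL M (\<lambda>\<omega>. R (Y \<omega>)) P' = (\<integral>\<^sup>+\<omega>. mean_KL (\<kappa> (S \<omega>)) R P' \<partial>M)" .
  qed
  have [measurable]: "\<mu> \<in> borel_measurable B"
    unfolding \<mu>_def mean_stat_def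
    by (intro measurable_compose[OF \<kappa>' integral_measurable_subprob_algebra]
          measurable_compose[OF R' integral_measurable_subprob_algebra] T_measurable_lam)
  \<comment> \<open>The exceptional set is fixed by the reference Q and by the existence of the
    conditional minimizers, so one null set serves all P' simultaneously.\<close>
  have decomp: "AE \<omega> in M. ?q \<omega> \<in> \<P> \<and> mean_stat T (?q \<omega>) = \<mu> (S \<omega>) \<and>
      (\<forall>P'\<in>\<P>. mean_KL (\<kappa> (S \<omega>)) R P' = KL (?q \<omega>) P' + ?v \<omega>)"
  proof -
    have "AE \<omega> in M. mean_KL (\<kappa> (S \<omega>)) R Q \<noteq> \<infinity>"
      using Q by (intro nn_integral_PInf_AE) (auto simp: KL_total[symmetric] less_top)
    moreover have "AE \<omega> in M. dist_mean_exists \<P> (\<kappa> (S \<omega>)) R"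
      using AE_distrD[OF S ex] .
    ultimately show ?thesis
      using AE_space
    proof eventually_elim
      case (elim \<omega>)
      have "\<kappa> (S \<omega>) \<in> space (prob_algebra N)"
        using elim(3) by (intro measurable_space[OF \<kappa>] measurable_space[OF S])
      then have prob: "prob_space (\<kappa> (S \<omega>))" and sets: "sets (\<kappa> (S \<omega>)) = sets N"
        by (auto simp: space_prob_algebra)
      interpret \<kappa>: prob_space "\<kappa> (S \<omega>)" by (rule prob)
      interpret random_distribution lam P0 T \<P> "\<kappa> (S \<omega>)" R
      proof unfold_locales
        show "R \<in> \<kappa> (S \<omega>) \<rightarrow>\<^sub>M prob_algebra lam"
          using R(1) by (simp only: measurable_cong_sets[OF sets refl])
        show "R y \<in> dominated_probs lam" if "y \<in> space (\<kappa> (S \<omega>))" for y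
          using that R(2) by (simp only: sets_eq_imp_space_eq[OF sets])
        show "(\<lambda>y. KL (R y) P') \<in> borel_measurable (\<kappa> (S \<omega>))" if "P' \<in> \<P>" for P'
          using R(3)[OF that] by (simp only: measurable_cong_sets[OF sets refl])
      qed
      note min = dist_mean_is_arg_min[OF elim(2)]
      \<comment> \<open>The conditional minimum lies below the conditional mean divergence from Q,
        which gives the finiteness required by \<open>pythagoras\<close>.\<close>
      have "dist_var \<P> (\<kappa> (S \<omega>)) R \<le> mean_KL (\<kappa> (S \<omega>)) R Q"
        unfolding dist_var_def using Q(1) by (rule INF_lower)
      then have fin: "mean_KL (\<kappa> (S \<omega>)) R (?q \<omega>) < \<infinity>"
        using elim(1) unfolding dist_var_eq_mean_KL[OF min] by (auto simp: less_top[symmetric] top_unique)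
      show ?case
        using mean_stat_arg_min[OF min fin] pythagoras[OF min fin] min[unfolded is_arg_min_def, THEN conjunct1]
        unfolding dist_var_eq_mean_KL[OF min] \<mu>_def overall_mean_def by blast
    qed
  qed
  obtain \<theta> a \<theta>' a' where m: "member \<theta> a Q" "member \<theta>' a' P"
    using ex_member[OF Q(1)] ex_member[OF P] by blast
  txt \<open>
    \<open>?q\<close> and \<open>?v\<close> depend on a choice of minimizers and need not be measurable; they are replaced by
    measurable functions that agree with them almost everywhere.
  \<close>
  define v where "v \<omega> = mean_KL (\<kappa> (S \<omega>)) R Q - KL_dual \<theta> a (\<mu> (S \<omega>))" for \<omega>
  have [measurable]: "v \<in> borel_measurable M"
    using Q(1) unfolding v_def[abs_def] by measurable
  have dual: "AE \<omega> in M. KL (?q \<omega>) P = KL_dual \<theta>' a' (\<mu> (S \<omega>))"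
    using decomp by eventually_elim (use KL_eq_dual[OF _ m(2)] in auto)
  have var: "AE \<omega> in M. ?v \<omega> = v \<omega>"
    using decomp
  proof eventually_elim
    case (elim \<omega>)
    then obtain \<theta>\<^sub>0 a\<^sub>0 where "member \<theta>\<^sub>0 a\<^sub>0 (?q \<omega>)" using ex_member by blast
    \<comment> \<open>Subtraction in \<open>ennreal\<close> cancels only a finite summand, hence the
      check that this divergence is not \<top>.\<close>
    then have "KL (?q \<omega>) Q \<noteq> \<top>" using KL_members(1)[OF _ m(1)] by simp
    moreover have "v \<omega> = (KL (?q \<omega>) Q + ?v \<omega>) - KL (?q \<omega>) Q"
      using elim Q(1) KL_eq_dual[OF _ m(1), of "?q \<omega>"] by (simp add: v_def)
    ultimately show ?case by simp
  qed
  have "mean_KL M (\<lambda>\<omega>. R (Y \<omega>)) P = (\<integral>\<^sup>+\<omega>. KL_dual \<theta>' a' (\<mu> (S \<omega>)) + v \<omega> \<partial>M)"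
    unfolding KL_total[OF P]
    by (intro nn_integral_cong_AE) (use decomp dual var in eventually_elim, use P in auto)
  also have "\<dots> = (\<integral>\<^sup>+\<omega>. KL_dual \<theta>' a' (\<mu> (S \<omega>)) \<partial>M) + (\<integral>\<^sup>+\<omega>. v \<omega> \<partial>M)"
    by (rule nn_integral_add) auto
  also have "(\<integral>\<^sup>+\<omega>. KL_dual \<theta>' a' (\<mu> (S \<omega>)) \<partial>M) = mean_KL M ?q P"
    unfolding mean_KL_def by (intro nn_integral_cong_AE) (use dual in eventually_elim, simp)
  also have "(\<integral>\<^sup>+\<omega>. v \<omega> \<partial>M) = (\<integral>\<^sup>+\<omega>. ?v \<omega> \<partial>M)"
    by (intro nn_integral_cong_AE) (use var in eventually_elim, simp)
  finally show ?thesis .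
qed

end

text \<open>Finiteness of c is essential, since an infinite constant would make every feasible point
  minimal. Equality of the whole predicates, beyond a common minimizer, is what transfers the choice
  made by \<open>arg_min\<close>.\<close>

lemma is_arg_min_add_const:
  fixes f g :: "'a \<Rightarrow> ennreal"
  assumes "\<And>x. P x \<Longrightarrow> f x = g x + c" "c < \<infinity>"
  shows "is_arg_min f P = is_arg_min g P"
  using assms by (auto simp: fun_eq_iff is_arg_min_linorder add.commute[of _ c])

section \<open>Estimators based on an i.i.d. sample\<close>

lemma dist_estimator_measurable:
  assumes "dist_estimator lam \<P> n R"
  shows "R \<in> sample_space n lam \<rightarrow>\<^sub>M prob_algebra lam"
proof (intro measurable_prob_algebraI measurable_subprob_algebra)
  let ?N = "sample_space n lam"
  show prob: "prob_space (R x)" and "sets (R x) = sets lam" if "x \<in> space ?N" for x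
    using assms that by (auto simp: dist_estimator_def dominated_probs_def)
  then show "subprob_space (R x)" if "x \<in> space ?N" for x
    using that by (simp add: prob_space_imp_subprob_space)
  fix A assume "A \<in> sets lam"
  then have "(\<lambda>x. ennreal (measure (R x) A)) \<in> borel_measurable ?N"
    using assms by (auto simp: dist_estimator_def)
  then show "(\<lambda>x. emeasure (R x) A) \<in> borel_measurable ?N"
    by (rule measurable_cong[THEN iffD1, rotated])
       (metis prob finite_measure.emeasure_eq_measure prob_space.finite_measure)
qed

lemma iid_sample_measurable:
  assumes "prob_space M" "iid_sample M lam n X R0"
  shows "sample_vec n X \<in> M \<rightarrow>\<^sub>M sample_space n lam"
  using assms unfolding sample_vec_def
  by (intro measurable_restrict) (auto simp: iid_sample_def prob_space.indep_vars_def)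

theorem theorem3p2:
  fixes lam R0 P0 :: "'a measure"
    and T :: "'a \<Rightarrow> real ^ 'd"
    and \<P> :: "'a measure set"
    and M :: "'w measure"
    and n :: nat
    and X :: "nat \<Rightarrow> 'w \<Rightarrow> 'a"
    and R :: "(nat \<Rightarrow> 'a) \<Rightarrow> 'a measure"
  defines "RX \<equiv> \<lambda>\<omega>. R (sample_vec n X \<omega>)"
  assumes "sigma_finite_measure lam"
    and "R0 \<in> dominated_probs lam" and "full_support lam R0"
    and "prob_space M" and "iid_sample M lam n X R0"
    and "exponential_family lam P0 T \<P>" and "open (canonical_params P0 T \<P>)"
    and "dist_estimator lam \<P> n R"
    and "dist_mean_exists \<P> M RX" and "dist_var \<P> M RX < \<infinity>"
  shows "(\<forall>P\<in>\<P>. (\<integral>\<^sup>+ \<omega>. KL (RX \<omega>) P \<partial>M) = KL (dist_mean \<P> M RX) P + dist_var \<P> M RX)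
    \<and> (\<forall>(S :: 'w \<Rightarrow> real ^ 'k) \<kappa>.
         S \<in> borel_measurable M \<longrightarrow>
         cond_distribution M (sample_space n lam) (sample_vec n X) S \<kappa> \<longrightarrow>
         (AE s in distr M borel S. dist_mean_exists \<P> (\<kappa> s) R) \<longrightarrow>
           dist_mean_exists \<P> M (\<lambda>\<omega>. dist_mean \<P> (\<kappa> (S \<omega>)) R)
         \<and> dist_mean \<P> M RX = dist_mean \<P> M (\<lambda>\<omega>. dist_mean \<P> (\<kappa> (S \<omega>)) R)
         \<and> dist_var \<P> M RX =
             dist_var \<P> M (\<lambda>\<omega>. dist_mean \<P> (\<kappa> (S \<omega>)) R)
             + (\<integral>\<^sup>+ \<omega>. dist_var \<P> (\<kappa> (S \<omega>)) R \<partial>M))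
    \<and> integrable (dist_mean \<P> M RX) T
    \<and> (AE \<omega> in M. integrable (RX \<omega>) T)
    \<and> integrable M (\<lambda>\<omega>. mean_stat T (RX \<omega>))
    \<and> mean_stat T (dist_mean \<P> M RX) = (\<integral>\<omega>. mean_stat T (RX \<omega>) \<partial>M)"
proof -
  let ?N = "sample_space n lam"
  interpret M: prob_space M by fact
  interpret open_exponential_family lam P0 T \<P> by (rule open_exponential_family.intro) fact+
  note R = dist_estimator_measurable[OF \<open>dist_estimator lam \<P> n R\<close>]
  note Y = iid_sample_measurable[OF \<open>prob_space M\<close> \<open>iid_sample M lam n X R0\<close>]
  have dom: "\<And>y. y \<in> space ?N \<Longrightarrow> R y \<in> dominated_probs lam"
    and meas: "\<And>P. P \<in> \<P> \<Longrightarrow> (\<lambda>y. KL (R y) P) \<in> borel_measurable ?N"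
    using \<open>dist_estimator lam \<P> n R\<close> by (auto simp: dist_estimator_def)
  interpret random_distribution lam P0 T \<P> M RX
    unfolding RX_def
    using R dom meas measurable_space[OF Y] by unfold_locales (auto intro: measurable_compose[OF Y])
  define Q where "Q = dist_mean \<P> M RX"
  have min: "is_arg_min (mean_KL M RX) (\<lambda>P. P \<in> \<P>) Q"
    unfolding Q_def by (rule dist_mean_is_arg_min) fact
  then have Q: "Q \<in> \<P>" by (simp add: is_arg_min_def)
  note var = dist_var_eq_mean_KL[OF min]
  have fin: "mean_KL M RX Q < \<infinity>" using var \<open>dist_var \<P> M RX < \<infinity>\<close> by simp
  have "dist_mean_exists \<P> M (\<lambda>\<omega>. dist_mean \<P> (\<kappa> (S \<omega>)) R)
      \<and> Q = dist_mean \<P> M (\<lambda>\<omega>. dist_mean \<P> (\<kappa> (S \<omega>)) R)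
      \<and> dist_var \<P> M RX = dist_var \<P> M (\<lambda>\<omega>. dist_mean \<P> (\<kappa> (S \<omega>)) R)
          + (\<integral>\<^sup>+ \<omega>. dist_var \<P> (\<kappa> (S \<omega>)) R \<partial>M)"
    if S: "S \<in> borel_measurable M" and cond: "cond_distribution M ?N (sample_vec n X) S \<kappa>"
      and ex: "AE s in distr M borel S. dist_mean_exists \<P> (\<kappa> s) R"
    for S :: "'w \<Rightarrow> real ^ 'k" and \<kappa>
  proof -
    let ?q = "\<lambda>\<omega>. dist_mean \<P> (\<kappa> (S \<omega>)) R" and ?c = "\<integral>\<^sup>+ \<omega>. dist_var \<P> (\<kappa> (S \<omega>)) R \<partial>M"
    have \<kappa>: "\<kappa> \<in> borel \<rightarrow>\<^sub>M prob_algebra ?N" using cond by (simp add: cond_distribution_def)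
    have law: "emeasure (distr M ?N (sample_vec n X)) A = (\<integral>\<^sup>+s. emeasure (\<kappa> s) A \<partial>distr M borel S)"
      if "A \<in> sets ?N" for A
    proof -
      have *: "\<forall>A\<in>sets borel. \<forall>B\<in>sets ?N. emeasure M {\<omega>\<in>space M. S \<omega> \<in> A \<and> sample_vec n X \<omega> \<in> B} =
          (\<integral>\<^sup>+ s\<in>A. emeasure (\<kappa> s) B \<partial>distr M borel S)"
        using cond unfolding cond_distribution_def by (rule conjunct2)
      \<comment> \<open>Taking the whole space as the event for S leaves the marginal law of the
        sample.\<close>
      have "emeasure (distr M ?N (sample_vec n X)) A = emeasure M {\<omega>\<in>space M. S \<omega> \<in> UNIV \<and> sample_vec n X \<omega> \<in> A}"
        using that Y by (simp add: emeasure_distr vimage_def Int_def conj_commute)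
      also have "\<dots> = (\<integral>\<^sup>+s\<in>UNIV. emeasure (\<kappa> s) A \<partial>distr M borel S)"
        by (rule bspec[OF bspec[OF *] that]) simp
      finally show ?thesis by simp
    qed
    have eq: "mean_KL M RX P = mean_KL M ?q P + ?c" if "P \<in> \<P>" for P
      unfolding RX_def
      by (rule mean_KL_disintegrate[OF \<open>prob_space M\<close> Y S \<kappa> law R dom meas ex Q _ that])
         (use fin in \<open>simp_all add: RX_def\<close>)
    \<comment> \<open>The mean conditional variance is a summand of the finite mean divergence from
      Q.\<close>
    have c: "?c < \<infinity>" using fin eq[OF Q] by (auto simp: less_top[symmetric])
    have same: "is_arg_min (mean_KL M RX) (\<lambda>P. P \<in> \<P>) = is_arg_min (mean_KL M ?q) (\<lambda>P. P \<in> \<P>)"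
      using eq c by (rule is_arg_min_add_const)
    have "dist_mean_exists \<P> M ?q" using min unfolding dist_mean_exists_def same by blast
    \<comment> \<open>Since \<open>arg_min\<close> is a Hilbert choice from the set of minimizers,
      equal predicates yield literally the same measure, with no appeal to uniqueness.\<close>
    moreover have "Q = dist_mean \<P> M ?q" unfolding Q_def dist_mean_def arg_min_def same ..
    moreover have "dist_var \<P> M RX = dist_var \<P> M ?q + ?c"
      using var eq[OF Q] dist_var_eq_mean_KL[OF min[unfolded same]] by simp
    ultimately show ?thesis by blast
  qed
  moreover have "(\<integral>\<^sup>+ \<omega>. KL (RX \<omega>) P \<partial>M) = KL Q P + dist_var \<P> M RX" if "P \<in> \<P>" for P
    using pythagoras[OF min fin that] unfolding var by (simp add: mean_KL_def)
  \<comment> \<open>The criterion \<open>integrable_T\<close> applies to Q relative to itself,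
    because \<open>KL Q Q = 0\<close>.\<close>
  moreover have "integrable Q T"
    using integrable_T[OF Q family_dominated[OF Q]] KL_self[OF Q] by simp
  ultimately show ?thesis
    using AE_integrable_T[OF Q fin] integrable_mean_stat[OF Q fin] mean_stat_arg_min[OF min fin]
    unfolding Q_def overall_mean_def by blast
qed

end
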